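(* Let $S\subseteq\mathbb N^2$ be a symmetric (local) good semigroup with projections $S_1,S_2\subseteq\mathbb N$ on the two coordinates, minimal nonzero element $\boldsymbol e=(e_1,e_2)$, $\boldsymbol\gamma=(\gamma_1,\gamma_2)$, and Apéry set $\mathrm{Ap}(S)$. (1) If $\alpha\in S$ is an absolute element, then also $\boldsymbol\gamma-\alpha\in S$ and it is an absolute element. (2) The number of absolute elements of $S$ is $n(S_1)-b(S_1)=n(S_2)-b(S_2)$, where $n(S_i)=|S_i\cap\{0,1,\dots,\gamma_i\}|$ and $b(S_i)=|\mathbb N\setminus S_i|$. (3) For $\alpha\in S$: $\alpha\in\mathrm{Ap}(S)$ if and only if $\Delta^S(\boldsymbol\gamma+\boldsymbol e-\alpha)\ne\emptyset$. (4) If $\alpha\in\mathrm{Ap}(S)$, then $\Delta^S(\boldsymbol\gamma+\boldsymbol e-\alpha)\subseteq\mathrm{Ap}(S)$. (5) Let $\alpha\in\mathbb N^2$. If $\Delta^S(\alpha)\subseteq\mathrm{Ap}(S)$ (possibly $\Delta^S(\alpha)=\emptyset$), then $\boldsymbol\gamma+\boldsymbol e-\alpha\in S$. (6) Let $\alpha\in\mathrm{Ap}(S)$. Then for $i=1,2$: $\Delta_i^S(\boldsymbol\gamma+\boldsymbol e-\alpha)=\emptyset$ if and only if $\Delta_i^S(\alpha)\nsubseteq\mathrm{Ap}(S)$.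
   Context: On $\mathbb Z^2$, $\le$ is the componentwise order and $\alpha\wedge\beta$ the componentwise minimum; $\mathbb N$ is the set of nonnegative integers. A good semigroup is a submonoid $S$ of $(\mathbb N^2,+)$ such that: (G1) $\alpha,\beta\in S\Rightarrow\alpha\wedge\beta\in S$; (G2) if $\alpha,\beta\in S$ and $\alpha_i=\beta_i$ for some $i\in\{1,2\}$, where $j$ is the other index, then there is $\delta\in S$ with $\delta_i>\alpha_i=\beta_i$, $\delta_j\ge\min\{\alpha_j,\beta_j\}$, and $\delta_j=\min\{\alpha_j,\beta_j\}$ if $\alpha_j\neq\beta_j$; (G3) there is $c\in S$ with $c+\mathbb N^2\subseteq S$. All good semigroups are assumed local: $(0,0)$ is the only element with a zero component. $\boldsymbol e=(e_1,e_2)$ is the minimum of $S\setminus\{(0,0)\}$, and $\mathrm{Ap}(S)=\{\alpha\in S:\alpha-\boldsymbol e\notin S\}$. The conductor is $\boldsymbol c=\min\{\alpha\in\mathbb Z^2:\alpha+\mathbb N^2\subseteq S\}$ and $\boldsymbol\gamma=\boldsymbol c-(1,1)$. For $\alpha\in\mathbb Z^2$: $\Delta_i(\alpha)=\{\beta\in\mathbb Z^2:\beta_i=\alpha_i,\ \beta_j>\alpha_j\text{ for }j\ne i\}$, $\Delta_i^S(\alpha)=\Delta_i(\alpha)\cap S$, $\Delta^S(\alpha)=\Delta_1^S(\alpha)\cup\Delta_2^S(\alpha)$. An element $\alpha\in S$ is absolute if $\Delta^S(\alpha)=\emptyset$. $S$ is symmetric if for every $\alpha\in\mathbb N^2$: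 $\alpha\in S\iff\Delta^S(\boldsymbol\gamma-\alpha)=\emptyset$. *)

theory Defs
  imports "HOL-Analysis.Analysis"
begin

text \<open>
  \<open>\<int>\<^sup>2\<close> is the type \<open>int ^ 2\<close>: its order is componentwise, \<open>0\<close> is \<open>(0,0)\<close> and \<open>1\<close> is \<open>(1,1)\<close>.
  The index type \<open>2\<close> has exactly the two elements \<open>1\<close> and \<open>2\<close>, so for \<open>i j :: 2\<close> the condition
  \<open>i \<noteq> j\<close> says that \<open>j\<close> is the index other than \<open>i\<close>.
\<close>

definition N2 :: "(int ^ 2) set" where
  "N2 = {\<alpha>. 0 \<le> \<alpha>}"

text \<open>The library provides no binary infimum on \<open>int ^ 2\<close>.\<close>

definition meet :: "int ^ 2 \<Rightarrow> int ^ 2 \<Rightarrow> int ^ 2" where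
  "meet \<alpha> \<beta> = (\<chi> i. min (\<alpha> $ i) (\<beta> $ i))"

definition good_semigroup :: "(int ^ 2) set \<Rightarrow> bool" where
  "good_semigroup S \<longleftrightarrow>
     S \<subseteq> N2 \<and> 0 \<in> S \<and> (\<forall>\<alpha>\<in>S. \<forall>\<beta>\<in>S. \<alpha> + \<beta> \<in> S) \<and>
     (\<forall>\<alpha>\<in>S. \<forall>\<beta>\<in>S. meet \<alpha> \<beta> \<in> S) \<and>
     (\<forall>\<alpha>\<in>S. \<forall>\<beta>\<in>S. \<forall>i j. i \<noteq> j \<and> \<alpha> $ i = \<beta> $ i \<longrightarrow>
        (\<exists>\<delta>\<in>S. \<delta> $ i > \<alpha> $ i \<and> \<delta> $ j \<ge> min (\<alpha> $ j) (\<beta> $ j) \<and>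
                (\<alpha> $ j \<noteq> \<beta> $ j \<longrightarrow> \<delta> $ j = min (\<alpha> $ j) (\<beta> $ j)))) \<and>
     (\<exists>c\<in>S. \<forall>\<nu>\<in>N2. c + \<nu> \<in> S)"

definition local_semigroup :: "(int ^ 2) set \<Rightarrow> bool" where
  "local_semigroup S \<longleftrightarrow> (\<forall>\<alpha>\<in>S. (\<exists>i. \<alpha> $ i = 0) \<longrightarrow> \<alpha> = 0)"

text \<open>
  \<open>LEAST\<close> denotes the minimum for the componentwise partial order. Both minima below exist for a
  local good semigroup, because the sets in question are closed under \<open>meet\<close>.
\<close>

definition min_elem :: "(int ^ 2) set \<Rightarrow> int ^ 2" where
  "min_elem S = (LEAST \<alpha>. \<alpha> \<in> S - {0})"

definition conductor :: "(int ^ 2) set \<Rightarrow> int ^ 2" where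
  "conductor S = (LEAST \<alpha>. \<forall>\<nu>\<in>N2. \<alpha> + \<nu> \<in> S)"

definition gam :: "(int ^ 2) set \<Rightarrow> int ^ 2" where
  "gam S = conductor S - 1"

definition Ap :: "(int ^ 2) set \<Rightarrow> (int ^ 2) set" where
  "Ap S = {\<alpha> \<in> S. \<alpha> - min_elem S \<notin> S}"

definition Delta_comp :: "2 \<Rightarrow> int ^ 2 \<Rightarrow> (int ^ 2) set" where
  "Delta_comp i \<alpha> = {\<beta>. \<beta> $ i = \<alpha> $ i \<and> (\<forall>j. j \<noteq> i \<longrightarrow> \<beta> $ j > \<alpha> $ j)}"

definition DeltaS_comp :: "(int ^ 2) set \<Rightarrow> 2 \<Rightarrow> int ^ 2 \<Rightarrow> (int ^ 2) set" where
  "DeltaS_comp S i \<alpha> = Delta_comp i \<alpha> \<inter> S"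

definition DeltaS :: "(int ^ 2) set \<Rightarrow> int ^ 2 \<Rightarrow> (int ^ 2) set" where
  "DeltaS S \<alpha> = DeltaS_comp S 1 \<alpha> \<union> DeltaS_comp S 2 \<alpha>"

definition absolute_elem :: "(int ^ 2) set \<Rightarrow> int ^ 2 \<Rightarrow> bool" where
  "absolute_elem S \<alpha> \<longleftrightarrow> \<alpha> \<in> S \<and> DeltaS S \<alpha> = {}"

definition symmetric_semigroup :: "(int ^ 2) set \<Rightarrow> bool" where
  "symmetric_semigroup S \<longleftrightarrow> (\<forall>\<alpha>\<in>N2. \<alpha> \<in> S \<longleftrightarrow> DeltaS S (gam S - \<alpha>) = {})"

definition proj :: "(int ^ 2) set \<Rightarrow> 2 \<Rightarrow> int set" where
  "proj S i = (\<lambda>\<alpha>. \<alpha> $ i) ` S"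

definition n_proj :: "(int ^ 2) set \<Rightarrow> 2 \<Rightarrow> nat" where
  "n_proj S i = card (proj S i \<inter> {0..gam S $ i})"

definition b_proj :: "(int ^ 2) set \<Rightarrow> 2 \<Rightarrow> nat" where
  "b_proj S i = card ({0..} - proj S i)"

end

theory Submission
  imports Defs
begin

text \<open>
  The symmetry condition holds on all of \<open>\<int>\<^sup>2\<close>, not just on \<open>\<nat>\<^sup>2\<close>, since \<open>\<Delta>\<^sup>S\<close> is nonempty at every
  point having a coordinate beyond \<open>\<gamma>\<close>. Parts (1), (3), (4), (5) are then translations by \<open>\<gamma>\<close> and
  \<open>e\<close>. For (6), put \<open>\<delta> = \<alpha> - e \<notin> S\<close>: if \<open>\<Delta>\<^sub>i\<close> were nonempty at both \<open>\<delta>\<close> and \<open>\<gamma> - \<delta>\<close>, adding the two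
  elements would contradict \<open>\<Delta>\<^sup>S(\<gamma>) = \<emptyset>\<close>; if it were empty at both, then \<open>\<gamma> - \<delta> \<in> S\<close> and (G2)
  yields a contradiction. For (2), an absolute element is the top of a bounded column, and the
  column over \<open>x \<in> S\<^sub>i\<close> is bounded iff \<open>\<gamma>\<^sub>i - x \<in> S\<^sub>i\<close>; the remaining elements of \<open>S\<^sub>i\<close> below \<open>\<gamma>\<^sub>i\<close> are
  the reflections \<open>\<gamma>\<^sub>i - x\<close> of the gaps \<open>x\<close> of \<open>S\<^sub>i\<close>.
\<close>

section \<open>Two-element index sets and minima of meet-closed sets\<close>

lemma index2_cases:
  fixes i j k :: 2
  assumes "i \<noteq> j"
  shows "k = i \<or> k = j"
  using exhaust_2[of i] exhaust_2[of j] exhaust_2[of k] assms by auto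

lemma other_index:
  fixes i :: 2
  obtains j where "i \<noteq> j"
  by (metis one_neq_zero add_cancel_left_right)

lemma all_index2:
  fixes i j :: 2
  assumes "i \<noteq> j"
  shows "(\<forall>k. P k) \<longleftrightarrow> P i \<and> P j"
  using index2_cases[OF assms] by metis

lemma mem_DeltaS_comp:
  assumes "i \<noteq> j"
  shows "\<beta> \<in> DeltaS_comp S i \<alpha> \<longleftrightarrow> \<beta> \<in> S \<and> \<beta> $ i = \<alpha> $ i \<and> \<beta> $ j > \<alpha> $ j"
  using index2_cases[OF assms] assms unfolding DeltaS_comp_def Delta_comp_def by auto

lemma DeltaS_eq:
  assumes "i \<noteq> j"
  shows "DeltaS S \<alpha> = DeltaS_comp S i \<alpha> \<union> DeltaS_comp S j \<alpha>"
  using exhaust_2[of i] exhaust_2[of j] assms unfolding DeltaS_def by auto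

text \<open>An element with least coordinate sum is the minimum: its meet with any other element
  lies in \<open>X\<close>, has no smaller sum, and so equals it. The bound by \<open>N2\<close>
  keeps \<open>nat\<close> from truncating these sums.\<close>

lemma Least_in_meet_closed:
  fixes X :: "(int ^ 2) set"
  assumes "X \<noteq> {}" and pos: "X \<subseteq> N2"
    and meet: "\<And>\<alpha> \<beta>. \<alpha> \<in> X \<Longrightarrow> \<beta> \<in> X \<Longrightarrow> meet \<alpha> \<beta> \<in> X"
  shows "(LEAST \<alpha>. \<alpha> \<in> X) \<in> X"
proof -
  define f where "f \<alpha> = nat (\<alpha> $ 1 + \<alpha> $ 2)" for \<alpha> :: "int ^ 2"
  from assms(1) obtain \<alpha> where \<alpha>: "\<alpha> \<in> X" and min: "\<And>\<beta>. \<beta> \<in> X \<Longrightarrow> f \<alpha> \<le> f \<beta>"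
    using ex_has_least_nat[of "\<lambda>\<alpha>. \<alpha> \<in> X" _ f] by blast
  have le: "\<alpha> \<le> \<beta>" if \<beta>: "\<beta> \<in> X" for \<beta>
  proof -
    have m: "meet \<alpha> \<beta> \<in> X" using meet \<alpha> \<beta> .
    have "f \<alpha> \<le> f (meet \<alpha> \<beta>)" using min m .
    moreover have "0 \<le> meet \<alpha> \<beta>" using m pos by (auto simp: N2_def)
    ultimately show ?thesis
      by (auto simp: f_def meet_def less_eq_vec_def forall_2)
  qed
  have "(LEAST \<alpha>. \<alpha> \<in> X) = \<alpha>" using \<alpha> le by (intro Least_equality)
  with \<alpha> show ?thesis by simp
qed

section \<open>Axioms in usable form, conductor and minimal nonzero element\<close>

locale sym_good_semigroup =
  fixes S :: "(int ^ 2) set"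
  assumes good: "good_semigroup S" and loc: "local_semigroup S" and sym: "symmetric_semigroup S"
begin

lemma nonneg: "\<alpha> \<in> S \<Longrightarrow> 0 \<le> \<alpha> $ i"
  using good unfolding good_semigroup_def N2_def less_eq_vec_def by auto

lemma zero_mem: "0 \<in> S"
  using good unfolding good_semigroup_def by auto

lemma add_mem: "\<alpha> \<in> S \<Longrightarrow> \<beta> \<in> S \<Longrightarrow> \<alpha> + \<beta> \<in> S"
  using good unfolding good_semigroup_def by auto

lemma meet_mem: "\<alpha> \<in> S \<Longrightarrow> \<beta> \<in> S \<Longrightarrow> meet \<alpha> \<beta> \<in> S"
  using good unfolding good_semigroup_def by auto

text \<open>This form trades a point of \<open>S\<close> beyond \<alpha> in direction
  \<open>j\<close> for one beyond \<alpha> in direction \<open>i\<close>.\<close>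

lemma G2:
  assumes "i \<noteq> j" "\<alpha> \<in> S" "\<beta> \<in> S" "\<alpha> $ i = \<beta> $ i" "\<alpha> $ j < \<beta> $ j"
  shows "\<exists>\<delta>\<in>S. \<delta> $ i > \<alpha> $ i \<and> \<delta> $ j = \<alpha> $ j"
proof -
  have "\<exists>\<delta>\<in>S. \<delta> $ i > \<alpha> $ i \<and> \<delta> $ j \<ge> min (\<alpha> $ j) (\<beta> $ j) \<and>
                (\<alpha> $ j \<noteq> \<beta> $ j \<longrightarrow> \<delta> $ j = min (\<alpha> $ j) (\<beta> $ j))"
    using good assms(1-4) unfolding good_semigroup_def by blast
  with assms(5) show ?thesis by auto
qed

lemma pos: "\<alpha> \<in> S \<Longrightarrow> \<alpha> \<noteq> 0 \<Longrightarrow> 0 < \<alpha> $ i"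
  using loc nonneg[of \<alpha> i] unfolding local_semigroup_def by force

text \<open>The set whose minimum is the conductor.\<close>

definition tails :: "(int ^ 2) set" where
  "tails = {\<alpha>. \<forall>\<nu>\<in>N2. \<alpha> + \<nu> \<in> S}"

lemma tails_iff: "\<alpha> \<in> tails \<longleftrightarrow> (\<forall>\<beta>\<ge>\<alpha>. \<beta> \<in> S)"
proof
  assume \<alpha>: "\<alpha> \<in> tails"
  show "\<forall>\<beta>\<ge>\<alpha>. \<beta> \<in> S"
  proof (intro allI impI)
    fix \<beta> assume "\<alpha> \<le> \<beta>"
    then have "\<beta> - \<alpha> \<in> N2" by (auto simp: N2_def less_eq_vec_def)
    with \<alpha> have "\<alpha> + (\<beta> - \<alpha>) \<in> S" unfolding tails_def by blast
    then show "\<beta> \<in> S" by simp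
  qed
next
  assume "\<forall>\<beta>\<ge>\<alpha>. \<beta> \<in> S"
  then show "\<alpha> \<in> tails" by (auto simp: tails_def N2_def less_eq_vec_def)
qed

text \<open>A point \<rho> above the meet of \<alpha> and \<beta> is itself the meet of its joins
  with \<alpha> and with \<beta>, and both joins lie in \<open>S\<close>.\<close>

lemma tails_meet:
  assumes "\<alpha> \<in> tails" "\<beta> \<in> tails"
  shows "meet \<alpha> \<beta> \<in> tails"
  unfolding tails_iff
proof (intro allI impI)
  fix \<rho> assume le: "meet \<alpha> \<beta> \<le> \<rho>"
  define jn where "jn \<sigma> = (\<chi> k. max (\<rho> $ k) (\<sigma> $ k))" for \<sigma> :: "int ^ 2"
  have "jn \<alpha> \<in> S" "jn \<beta> \<in> S"
    using assms by (auto simp: tails_iff jn_def less_eq_vec_def)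
  then have "meet (jn \<alpha>) (jn \<beta>) \<in> S" by (rule meet_mem)
  moreover have "meet (jn \<alpha>) (jn \<beta>) = \<rho>"
    unfolding vec_eq_iff
  proof
    fix k
    have "min (\<alpha> $ k) (\<beta> $ k) \<le> \<rho> $ k" using le by (simp add: meet_def less_eq_vec_def)
    then show "meet (jn \<alpha>) (jn \<beta>) $ k = \<rho> $ k" by (auto simp: meet_def jn_def)
  qed
  ultimately show "\<rho> \<in> S" by simp
qed

lemma conductor_mem_tails: "conductor S \<in> tails"
proof -
  have "tails \<noteq> {}" using good unfolding good_semigroup_def tails_def by auto
  moreover have "tails \<subseteq> N2" using nonneg by (auto simp: tails_iff N2_def less_eq_vec_def)
  ultimately have "(LEAST \<alpha>. \<alpha> \<in> tails) \<in> tails" using tails_meet by (rule Least_in_meet_closed)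
  then show ?thesis by (simp add: conductor_def tails_def)
qed

lemma above_gam: "(\<And>k. gam S $ k < \<alpha> $ k) \<Longrightarrow> \<alpha> \<in> S"
proof -
  assume less: "\<And>k. gam S $ k < \<alpha> $ k"
  have "conductor S $ k \<le> \<alpha> $ k" for k using less[of k] by (simp add: gam_def)
  then have "conductor S \<le> \<alpha>" by (simp add: less_eq_vec_def)
  with conductor_mem_tails show ?thesis by (simp add: tails_iff)
qed

lemma gam_nonneg: "0 \<le> gam S $ i"
proof -
  have c: "conductor S \<in> S" using conductor_mem_tails by (simp add: tails_iff)
  have "conductor S \<noteq> 0"
  proof
    assume "conductor S = 0"
    \<comment> \<open>The point (1,0) violates locality.\<close>
    then have "axis 1 1 \<in> S"
      using conductor_mem_tails by (auto simp: tails_iff less_eq_vec_def axis_def)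
    moreover have "axis 1 (1::int) $ (2::2) = 0" "axis 1 (1::int) $ (1::2) = 1"
      by (auto simp: axis_def)
    ultimately show False using pos[of "axis 1 1" 2] by force
  qed
  then show ?thesis using pos[OF c, of i] by (simp add: gam_def)
qed

lemma min_elem_mem: "min_elem S \<in> S"
proof -
  let ?\<alpha> = "conductor S + 1"
  have "?\<alpha> \<in> S" using conductor_mem_tails by (auto simp: tails_iff less_eq_vec_def)
  moreover have "?\<alpha> \<noteq> 0" using gam_nonneg[of 1] by (auto simp: gam_def vec_eq_iff forall_2)
  ultimately have "S - {0} \<noteq> {}" by blast
  moreover have "S - {0} \<subseteq> N2" using nonneg by (auto simp: N2_def less_eq_vec_def)
  moreover have "meet \<alpha> \<beta> \<in> S - {0}" if "\<alpha> \<in> S - {0}" "\<beta> \<in> S - {0}" for \<alpha> \<beta>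
  proof -
    \<comment> \<open>Locality makes all coordinates of nonzero elements positive, so their meet
      cannot be 0.\<close>
    have "0 < meet \<alpha> \<beta> $ 1" using that pos[of \<alpha> 1] pos[of \<beta> 1] by (simp add: meet_def)
    with that meet_mem show ?thesis by auto
  qed
  ultimately have "(LEAST \<alpha>. \<alpha> \<in> S - {0}) \<in> S - {0}" by (rule Least_in_meet_closed)
  then show ?thesis by (simp add: min_elem_def)
qed

section \<open>Symmetry on the whole plane and duality of the two components\<close>

lemma mem_iff: "\<alpha> \<in> S \<longleftrightarrow> DeltaS S (gam S - \<alpha>) = {}"
proof (cases "\<alpha> \<in> N2")
  case True
  then show ?thesis using sym unfolding symmetric_semigroup_def by blast
next
  case False
  then obtain i where i: "\<alpha> $ i < 0" by (auto simp: N2_def less_eq_vec_def not_le)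
  obtain j where ij: "i \<noteq> j" by (rule other_index)
  \<comment> \<open>Since \<open>\<alpha> $ i\<close> is negative, coordinate \<open>i\<close> of
    \<gamma> - \<alpha> already exceeds \<gamma>. The other coordinate is chosen beyond both
    \<gamma> and \<gamma> - \<alpha>.\<close>
  define \<beta> :: "int ^ 2" where
    "\<beta> = (\<chi> k. if k = i then gam S $ i - \<alpha> $ i else max (gam S $ j) (gam S $ j - \<alpha> $ j) + 1)"
  have \<beta>: "\<beta> $ i = gam S $ i - \<alpha> $ i" "\<beta> $ j = max (gam S $ j) (gam S $ j - \<alpha> $ j) + 1"
    using ij by (auto simp: \<beta>_def)
  have "\<beta> \<in> S"
  proof (rule above_gam)
    show "gam S $ k < \<beta> $ k" for k using index2_cases[OF ij, of k] \<beta> i by auto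
  qed
  then have "\<beta> \<in> DeltaS_comp S i (gam S - \<alpha>)" using \<beta> by (simp add: mem_DeltaS_comp[OF ij])
  then have "DeltaS S (gam S - \<alpha>) \<noteq> {}" by (auto simp: DeltaS_eq[OF ij])
  moreover have "\<alpha> \<notin> S" using i nonneg[of \<alpha> i] by auto
  ultimately show ?thesis by simp
qed

lemma gam_minus_mem_iff: "gam S - \<alpha> \<in> S \<longleftrightarrow> DeltaS S \<alpha> = {}"
  using mem_iff[of "gam S - \<alpha>"] by simp

lemma DeltaS_gam: "DeltaS S (gam S) = {}"
  using mem_iff[of 0] zero_mem by simp

lemma absolute_reflect: "absolute_elem S \<alpha> \<Longrightarrow> absolute_elem S (gam S - \<alpha>)"
  unfolding absolute_elem_def using mem_iff gam_minus_mem_iff by auto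

text \<open>Otherwise \<alpha> + \<beta> would lie in the empty set
  \<open>DeltaS S (gam S)\<close>.\<close>

lemma sum_le_gam:
  assumes "i \<noteq> j" "\<alpha> \<in> S" "\<beta> \<in> S" "\<alpha> $ i + \<beta> $ i = gam S $ i"
  shows "\<alpha> $ j + \<beta> $ j \<le> gam S $ j"
proof (rule ccontr)
  assume "\<not> ?thesis"
  then have "\<alpha> + \<beta> \<in> DeltaS_comp S i (gam S)"
    using assms add_mem by (simp add: mem_DeltaS_comp[OF assms(1)])
  then show False using DeltaS_gam by (auto simp: DeltaS_eq[OF assms(1)])
qed

text \<open>Applied later to \<alpha> - e for \<alpha> in the Apery set, which is where \<delta>
  outside \<open>S\<close> comes from.\<close>

lemma DeltaS_comp_duality:
  assumes "\<delta> \<notin> S"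
  shows "DeltaS_comp S i (gam S - \<delta>) = {} \<longleftrightarrow> DeltaS_comp S i \<delta> \<noteq> {}"
proof -
  have excl: "DeltaS_comp S i \<delta> = {} \<or> DeltaS_comp S i (gam S - \<delta>) = {}" for i
  proof (rule ccontr)
    obtain j where ij: "i \<noteq> j" by (rule other_index)
    assume "\<not> ?thesis"
    then obtain \<alpha> \<beta> where "\<alpha> \<in> DeltaS_comp S i \<delta>" "\<beta> \<in> DeltaS_comp S i (gam S - \<delta>)" by blast
    then show False using sum_le_gam[OF ij, of \<alpha> \<beta>] by (auto simp: mem_DeltaS_comp[OF ij])
  qed
  obtain j where ij: "i \<noteq> j" by (rule other_index)
  have "DeltaS_comp S i \<delta> \<noteq> {}" if empty: "DeltaS_comp S i (gam S - \<delta>) = {}"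
  proof
    assume "DeltaS_comp S i \<delta> = {}"
    \<comment> \<open>As \<delta> is not in \<open>S\<close>, symmetry makes some component at
      \<gamma> - \<delta> nonempty, and \<open>i\<close> is excluded.\<close>
    have "DeltaS_comp S j (gam S - \<delta>) \<noteq> {}"
      using mem_iff[of \<delta>] assms empty by (auto simp: DeltaS_eq[OF ij])
    then have "DeltaS_comp S j \<delta> = {}" using excl[of j] by blast
    with \<open>DeltaS_comp S i \<delta> = {}\<close> have mem: "gam S - \<delta> \<in> S"
      by (simp add: gam_minus_mem_iff DeltaS_eq[OF ij])
    obtain \<beta> where "\<beta> \<in> DeltaS_comp S j (gam S - \<delta>)"
      using \<open>DeltaS_comp S j (gam S - \<delta>) \<noteq> {}\<close> by blast
    then have \<beta>: "\<beta> \<in> S" "(gam S - \<delta>) $ j = \<beta> $ j" "(gam S - \<delta>) $ i < \<beta> $ i"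
      using mem_DeltaS_comp[OF ij[symmetric]] by auto
    \<comment> \<open>\<gamma> - \<delta> and \<beta> agree in coordinate \<open>j\<close>, so
      \<open>G2\<close> moves up along the line through \<gamma> - \<delta> with coordinate
      \<open>i\<close> fixed.\<close>
    obtain \<epsilon> where "\<epsilon> \<in> DeltaS_comp S i (gam S - \<delta>)"
      using G2[OF ij[symmetric] mem \<beta>] by (auto simp: mem_DeltaS_comp[OF ij])
    with empty show False by blast
  qed
  with excl[of i] show ?thesis by blast
qed

section \<open>Counting the absolute elements\<close>

lemma proj_gam_minus:
  assumes "x \<notin> proj S i"
  shows "gam S $ i - x \<in> proj S i"
proof -
  obtain j where ij: "i \<noteq> j" by (rule other_index)
  \<comment> \<open>A point just below the column over \<open>x\<close>: one component could meet
    \<open>S\<close> only in that column, the other only at coordinate -1, so both are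
    empty.\<close>
  define \<alpha> :: "int ^ 2" where "\<alpha> = (\<chi> k. if k = i then x else -1)"
  have \<alpha>: "\<alpha> $ i = x" "\<alpha> $ j = -1" using ij by (auto simp: \<alpha>_def)
  have "\<beta> $ i \<noteq> \<alpha> $ i" if "\<beta> \<in> S" for \<beta>
    using that assms \<alpha>(1) unfolding proj_def by (metis imageI)
  then have "DeltaS_comp S i \<alpha> = {}" by (auto simp: mem_DeltaS_comp[OF ij])
  moreover have "DeltaS_comp S j \<alpha> = {}"
    using nonneg[of _ j] \<alpha> by (force simp: mem_DeltaS_comp[OF ij[symmetric]])
  ultimately have "gam S - \<alpha> \<in> S" by (simp add: gam_minus_mem_iff DeltaS_eq[OF ij])
  then show ?thesis using \<alpha>(1) by (force simp: proj_def)
qed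

lemma proj_nonneg: "x \<in> proj S i \<Longrightarrow> 0 \<le> x"
  using nonneg by (auto simp: proj_def)

text \<open>Of two distinct elements in one column, the upper lies in the \<Delta>-set of the
  lower.\<close>

lemma absolute_inj: "inj_on (\<lambda>\<alpha>. \<alpha> $ i) {\<alpha>. absolute_elem S \<alpha>}"
proof (rule inj_onI)
  obtain j where ij: "i \<noteq> j" by (rule other_index)
  fix \<alpha> \<beta>
  assume ab: "\<alpha> \<in> {\<alpha>. absolute_elem S \<alpha>}" "\<beta> \<in> {\<alpha>. absolute_elem S \<alpha>}" and eq: "\<alpha> $ i = \<beta> $ i"
  then have "\<beta> \<notin> DeltaS_comp S i \<alpha>" "\<alpha> \<notin> DeltaS_comp S i \<beta>" "\<alpha> \<in> S" "\<beta> \<in> S"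
    by (auto simp: absolute_elem_def DeltaS_eq[OF ij])
  with eq have "\<alpha> $ j = \<beta> $ j" by (auto simp: mem_DeltaS_comp[OF ij])
  with eq show "\<alpha> = \<beta>" by (simp add: vec_eq_iff all_index2[OF ij])
qed

lemma absolute_image:
  "(\<lambda>\<alpha>. \<alpha> $ i) ` {\<alpha>. absolute_elem S \<alpha>} = {x \<in> proj S i. gam S $ i - x \<in> proj S i}"
proof (intro equalityI subsetI)
  fix x assume "x \<in> (\<lambda>\<alpha>. \<alpha> $ i) ` {\<alpha>. absolute_elem S \<alpha>}"
  then obtain \<alpha> where \<alpha>: "absolute_elem S \<alpha>" "x = \<alpha> $ i" by blast
  then have "\<alpha> \<in> S" "gam S - \<alpha> \<in> S" "gam S $ i - x = (gam S - \<alpha>) $ i"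
    using absolute_reflect by (auto simp: absolute_elem_def)
  then show "x \<in> {x \<in> proj S i. gam S $ i - x \<in> proj S i}"
    using \<alpha>(2) unfolding proj_def by blast
next
  obtain j where ij: "i \<noteq> j" by (rule other_index)
  fix x assume "x \<in> {x \<in> proj S i. gam S $ i - x \<in> proj S i}"
  then obtain \<alpha>0 \<beta> where x: "\<alpha>0 \<in> S" "\<alpha>0 $ i = x" "\<beta> \<in> S" "\<beta> $ i = gam S $ i - x"
    by (auto simp: proj_def)
  \<comment> \<open>An element over the reflected coordinate bounds the whole column by
    \<open>sum_le_gam\<close>.\<close>
  have bound: "\<alpha> $ j \<le> gam S $ j" if "\<alpha> \<in> S" "\<alpha> $ i = x" for \<alpha>
    using sum_le_gam[OF ij that(1) x(3)] that(2) x(4) nonneg[OF x(3), of j] by simp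
  obtain \<alpha> where \<alpha>: "\<alpha> \<in> S" "\<alpha> $ i = x"
    and max: "\<And>\<beta>. \<beta> \<in> S \<Longrightarrow> \<beta> $ i = x \<Longrightarrow> \<beta> $ j \<le> \<alpha> $ j"
  proof -
    \<comment> \<open>The top of the column minimizes the distance to \<gamma>; \<open>bound\<close>
      makes that distance nonnegative, so \<open>nat\<close> is faithful.\<close>
    have "\<exists>\<alpha>. (\<alpha> \<in> S \<and> \<alpha> $ i = x) \<and>
        (\<forall>\<beta>. \<beta> \<in> S \<and> \<beta> $ i = x \<longrightarrow> nat (gam S $ j - \<alpha> $ j) \<le> nat (gam S $ j - \<beta> $ j))"
      by (rule ex_has_least_nat[of _ \<alpha>0]) (use x in simp)
    then show thesis using that bound by force
  qed
  have i: "DeltaS_comp S i \<alpha> = {}" using max \<alpha>(2) by (force simp: mem_DeltaS_comp[OF ij])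
  have "DeltaS_comp S j \<alpha> = {}"
  proof (rule ccontr)
    assume "\<not> ?thesis"
    then obtain \<beta> where "\<beta> \<in> S" "\<alpha> $ j = \<beta> $ j" "\<alpha> $ i < \<beta> $ i"
      using mem_DeltaS_comp[OF ij[symmetric]] by fastforce
    \<comment> \<open>\<open>G2\<close> would produce a higher element in the same column.\<close>
    from G2[OF ij[symmetric] \<alpha>(1) this] show False using max \<alpha>(2) by force
  qed
  with i \<alpha>(1) have "absolute_elem S \<alpha>" by (simp add: absolute_elem_def DeltaS_eq[OF ij])
  with \<alpha>(2) show "x \<in> (\<lambda>\<alpha>. \<alpha> $ i) ` {\<alpha>. absolute_elem S \<alpha>}" by blast
qed

lemma absolute_card:
  "finite {\<alpha>. absolute_elem S \<alpha>}"
  "int (card {\<alpha>. absolute_elem S \<alpha>}) = int (n_proj S i) - int (b_proj S i)"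
proof -
  define N where "N = proj S i \<inter> {0..gam S $ i}"
  define G where "G = {0..} - proj S i"
  define A where "A = {x \<in> proj S i. gam S $ i - x \<in> proj S i}"
  let ?r = "\<lambda>x. gam S $ i - x"
  \<comment> \<open>An element \<open>x\<close> of \<open>N\<close> fails to be in \<open>A\<close>
    exactly when its reflection is a gap.\<close>
  have A: "A = N - ?r ` G"
  proof (intro equalityI subsetI)
    fix x assume "x \<in> A"
    then show "x \<in> N - ?r ` G"
      using proj_nonneg[of x i] proj_nonneg[of "?r x" i] by (auto simp: A_def N_def G_def)
  next
    fix x assume x: "x \<in> N - ?r ` G"
    then have "?r x \<notin> G" by (metis Diff_iff diff_diff_eq2 add_diff_cancel_left' image_eqI)
    with x show "x \<in> A" by (auto simp: A_def N_def G_def)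
  qed
  have sub: "?r ` G \<subseteq> N"
  proof
    fix y assume "y \<in> ?r ` G"
    then obtain x where "x \<in> G" "y = ?r x" by blast
    then show "y \<in> N" using proj_gam_minus[of x i] proj_nonneg[of "?r x" i]
      by (auto simp: G_def N_def)
  qed
  have finN: "finite N" by (simp add: N_def)
  have img: "(\<lambda>\<alpha>. \<alpha> $ i) ` {\<alpha>. absolute_elem S \<alpha>} = A"
    unfolding A_def by (rule absolute_image)
  show "finite {\<alpha>. absolute_elem S \<alpha>}"
    by (rule finite_imageD[OF _ absolute_inj[of i]]) (simp add: img A finN)
  have "card {\<alpha>. absolute_elem S \<alpha>} = card A"
    using card_image[OF absolute_inj[of i]] img by simp
  also have "\<dots> = card N - card (?r ` G)"
    unfolding A by (rule card_Diff_subset) (use sub finN finite_subset in auto)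
  \<comment> \<open>The inclusion \<open>sub\<close> makes the natural-number subtraction
    exact.\<close>
  finally have "int (card {\<alpha>. absolute_elem S \<alpha>}) = int (card N) - int (card (?r ` G))"
    using card_mono[OF finN sub] by simp
  also have "card (?r ` G) = card G" by (rule card_image) (auto intro: inj_onI)
  finally show "int (card {\<alpha>. absolute_elem S \<alpha>}) = int (n_proj S i) - int (b_proj S i)"
    by (simp add: n_proj_def b_proj_def N_def G_def)
qed

section \<open>The Apery set, by translation along the minimal nonzero element\<close>

lemma Ap_iff:
  assumes "\<alpha> \<in> S"
  shows "\<alpha> \<in> Ap S \<longleftrightarrow> DeltaS S (gam S + min_elem S - \<alpha>) \<noteq> {}"
  using assms mem_iff[of "\<alpha> - min_elem S"] by (simp add: Ap_def algebra_simps)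

text \<open>Translation by e maps the component at \<alpha> - e bijectively onto the elements of the
  component at \<alpha> outside \<open>Ap S\<close>.\<close>

lemma DeltaS_comp_not_subset_Ap:
  "\<not> DeltaS_comp S i \<alpha> \<subseteq> Ap S \<longleftrightarrow> DeltaS_comp S i (\<alpha> - min_elem S) \<noteq> {}"
proof -
  obtain j where ij: "i \<noteq> j" by (rule other_index)
  have "\<beta> - min_elem S \<in> DeltaS_comp S i (\<alpha> - min_elem S)"
    if "\<beta> \<in> DeltaS_comp S i \<alpha>" "\<beta> \<notin> Ap S" for \<beta>
    using that by (auto simp: mem_DeltaS_comp[OF ij] Ap_def)
  moreover have "\<beta> + min_elem S \<in> DeltaS_comp S i \<alpha> \<and> \<beta> + min_elem S \<notin> Ap S"
    if "\<beta> \<in> DeltaS_comp S i (\<alpha> - min_elem S)" for \<beta>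
    using that add_mem[OF _ min_elem_mem] by (auto simp: mem_DeltaS_comp[OF ij] Ap_def)
  ultimately show ?thesis by blast
qed

lemma DeltaS_subset_Ap_iff: "DeltaS S \<alpha> \<subseteq> Ap S \<longleftrightarrow> DeltaS S (\<alpha> - min_elem S) = {}"
  using DeltaS_comp_not_subset_Ap[of 1 \<alpha>] DeltaS_comp_not_subset_Ap[of 2 \<alpha>]
  unfolding DeltaS_def by auto

text \<open>After translation the claim is emptiness of \<open>DeltaS S (gam S - \<alpha>)\<close>,
  which is symmetry at \<alpha>.\<close>

lemma DeltaS_subset_Ap:
  assumes "\<alpha> \<in> S"
  shows "DeltaS S (gam S + min_elem S - \<alpha>) \<subseteq> Ap S"
  using assms mem_iff[of \<alpha>] unfolding DeltaS_subset_Ap_iff by (simp add: algebra_simps)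

lemma mem_if_DeltaS_subset_Ap:
  assumes "DeltaS S \<alpha> \<subseteq> Ap S"
  shows "gam S + min_elem S - \<alpha> \<in> S"
  using assms gam_minus_mem_iff[of "\<alpha> - min_elem S"] unfolding DeltaS_subset_Ap_iff
  by (simp add: algebra_simps)

lemma DeltaS_comp_empty_iff:
  assumes "\<alpha> \<in> Ap S"
  shows "DeltaS_comp S i (gam S + min_elem S - \<alpha>) = {} \<longleftrightarrow> \<not> DeltaS_comp S i \<alpha> \<subseteq> Ap S"
proof -
  have "\<alpha> - min_elem S \<notin> S" using assms by (simp add: Ap_def)
  from DeltaS_comp_duality[OF this, of i] show ?thesis
    unfolding DeltaS_comp_not_subset_Ap by (simp add: algebra_simps)
qed

end

theorem proposition4p3:
  fixes S :: "(int ^ 2) set"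
  assumes "good_semigroup S" and "local_semigroup S" and "symmetric_semigroup S"
  shows
    "(\<forall>\<alpha>\<in>S. absolute_elem S \<alpha> \<longrightarrow> gam S - \<alpha> \<in> S \<and> absolute_elem S (gam S - \<alpha>)) \<and>
     (finite {\<alpha>. absolute_elem S \<alpha>} \<and>
      int (card {\<alpha>. absolute_elem S \<alpha>}) = int (n_proj S 1) - int (b_proj S 1) \<and>
      int (n_proj S 1) - int (b_proj S 1) = int (n_proj S 2) - int (b_proj S 2)) \<and>
     (\<forall>\<alpha>\<in>S. \<alpha> \<in> Ap S \<longleftrightarrow> DeltaS S (gam S + min_elem S - \<alpha>) \<noteq> {}) \<and>
     (\<forall>\<alpha>\<in>Ap S. DeltaS S (gam S + min_elem S - \<alpha>) \<subseteq> Ap S) \<and>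
     (\<forall>\<alpha>\<in>N2. DeltaS S \<alpha> \<subseteq> Ap S \<longrightarrow> gam S + min_elem S - \<alpha> \<in> S) \<and>
     (\<forall>\<alpha>\<in>Ap S. \<forall>i::2.
        DeltaS_comp S i (gam S + min_elem S - \<alpha>) = {} \<longleftrightarrow> \<not> DeltaS_comp S i \<alpha> \<subseteq> Ap S)"
proof -
  interpret sym_good_semigroup S using assms by unfold_locales
  have "gam S - \<alpha> \<in> S \<and> absolute_elem S (gam S - \<alpha>)" if "absolute_elem S \<alpha>" for \<alpha>
    using absolute_reflect[OF that] by (simp add: absolute_elem_def)
  moreover have "\<alpha> \<in> S" if "\<alpha> \<in> Ap S" for \<alpha> using that by (simp add: Ap_def)
  ultimately show ?thesis
    using absolute_card(1) absolute_card(2)[of 1] absolute_card(2)[of 2]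
      Ap_iff DeltaS_subset_Ap mem_if_DeltaS_subset_Ap DeltaS_comp_empty_iff by simp
qed

end
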